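(* Let $\bar{\mathcal P}$ be the joint consistency set and $\mathcal P$ the set of data-consistent plants defined in the context, let $W\in\mathbb R^{f\times n}$ have full column rank with Moore–Penrose pseudoinverse $W^+$, and let $\eta>0$. Suppose that a matrix $K\in\mathbb R^{m\times n}$ and a matrix-valued function $M:\mathcal P\to\mathbb R^{f\times f}$ solve the following infinite-dimensional linear feasibility program: for all $(A,B,\Delta x,\Delta u)\in\bar{\mathcal P}$, $$1-\eta-\sum_{j=1}^{f}M_{ij}(A,B)\ge 0\qquad \text{for all } i\in\{1,\dots,f\},$$ $$M_{ij}(A,B)-\big(W(A+BK)W^+\big)_{ij}\ge 0\quad\text{and}\quad M_{ij}(A,B)+\big(W(A+BK)W^+\big)_{ij}\ge 0\qquad \text{for all } i,j\in\{1,\dots,f\}.$$ Then $A+BK$ is $W$-superstable for every $(A,B)\in\mathcal P$; that is, the single full-state-feedback controller $u_t=Kx_t$ $W$-superstabilizes all plants consistent with the data.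
   Context: Fix positive integers $n,m,L,f$ and an integer $T\ge 2$. The data consist of vectors $\hat x_t\in\mathbb R^n$ ($t=1,\dots,T$) and $\hat u_t\in\mathbb R^m$ ($t=1,\dots,T-1$). They are noisy observations $\hat x_t=x_t+\Delta x_t$, $\hat u_t=u_t+\Delta u_t$ of a trajectory of a linear system $x_{t+1}=Ax_t+Bu_t$ with $A\in\mathbb R^{n\times n}$, $B\in\mathbb R^{n\times m}$. Write $\Delta x=(\Delta x_1,\dots,\Delta x_T)\in\mathbb R^{nT}$ and $\Delta u=(\Delta u_1,\dots,\Delta u_{T-1})\in\mathbb R^{m(T-1)}$ for the stacked noise vectors. The noise is known to satisfy $\|F_\ell\Delta x+G_\ell\Delta u\|_2\le 1$ for $\ell=1,\dots,L$, where $F_\ell\in\mathbb R^{n_\ell\times nT}$ and $G_\ell\in\mathbb R^{n_\ell\times m(T-1)}$ are given matrices. For $(A,B)\in\mathbb R^{n\times n}\times\mathbb R^{n\times m}$ define the residuals $h^0_t(A,B)=\hat x_{t+1}-A\hat x_t-B\hat u_t$ for $t=1,\dots,T-1$. The joint consistency set $\bar{\mathcal P}\subset\mathbb R^{n\times n}\times\mathbb R^{n\times m}\times\mathbb R^{nT}\times\mathbb R^{m(T-1)}$ is the set of all $(A,B,\Delta x,\Delta u)$ such that $$\Delta x_{t+1}=A\Delta x_t+B\Delta u_t+h^0_t(A,B)\ \ (t=1,\dots,T-1),\qquad \|F_\ell\Delta x+G_\ell\Delta u\|_2\le 1\ \ (\ell=1,\dots,L).$$ The set of data-consistent plants is the projection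 $\mathcal P=\{(A,B):\exists(\Delta x,\Delta u)\text{ with }(A,B,\Delta x,\Delta u)\in\bar{\mathcal P}\}$. For $W\in\mathbb R^{f\times n}$ of full column rank (so that $\{x:\|Wx\|_\infty\le 1\}$ is compact), a matrix $A\in\mathbb R^{n\times n}$ (equivalently, the system $x_{t+1}=Ax_t$) is called $W$-superstable if $\|WAW^+\|_\infty<1$, where $\|\cdot\|_\infty$ is the $L_\infty$ operator norm (maximum absolute row sum). *)

theory Defs
  imports Complex_Main "HOL-Library.FuncSet" "Jordan_Normal_Form.DL_Rank"
begin

text \<open>
  Matrix and vector entries are indexed from 0; time \<open>t\<close> and constraint number \<open>\<ell>\<close> count from 1.
  A stacked noise vector \<open>(v\<^sub>1, ..., v\<^sub>k)\<close> with blocks of dimension \<open>d\<close> is one vector of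
  dimension \<open>d * k\<close>, and \<open>block d v t\<close> is its \<open>t\<close>-th block (meaningful for \<open>1 \<le> t \<le> k\<close>).
\<close>

definition block :: "nat \<Rightarrow> real vec \<Rightarrow> nat \<Rightarrow> real vec" where
  "block d v t = vec d (\<lambda>i. v $ ((t - 1) * d + i))"

definition norm2 :: "real vec \<Rightarrow> real" where
  "norm2 v = sqrt (\<Sum>i<dim_vec v. (v $ i)\<^sup>2)"

definition linf_norm :: "real mat \<Rightarrow> real" where
  "linf_norm X = (MAX i\<in>{..<dim_row X}. \<Sum>j<dim_col X. \<bar>X $$ (i, j)\<bar>)"

text \<open>The four Penrose conditions, for real matrices.\<close>

definition is_pinv :: "real mat \<Rightarrow> real mat \<Rightarrow> bool" where
  "is_pinv X Y \<longleftrightarrow> Y \<in> carrier_mat (dim_col X) (dim_row X)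
     \<and> X * Y * X = X \<and> Y * X * Y = Y
     \<and> transpose_mat (X * Y) = X * Y \<and> transpose_mat (Y * X) = Y * X"

definition pinv :: "real mat \<Rightarrow> real mat" where
  "pinv X = (THE Y. is_pinv X Y)"

definition full_column_rank :: "real mat \<Rightarrow> bool" where
  "full_column_rank X \<longleftrightarrow> vec_space.rank (dim_row X) X = dim_col X"

lemma is_pinv_unique:
  assumes Y: "is_pinv X Y" and Z: "is_pinv X Z"
  shows "Y = Z"
proof -
  define a b where "a = dim_row X" and "b = dim_col X"
  have X: "X \<in> carrier_mat a b" by (simp add: a_def b_def)
  have Yc: "Y \<in> carrier_mat b a" and Zc: "Z \<in> carrier_mat b a"
    using Y Z by (simp_all add: is_pinv_def a_def b_def)
  have 1: "X * Y = X * Z"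
  proof -
    have "X * Y = (X * Z * X) * Y" using Z by (simp add: is_pinv_def)
    also have "\<dots> = (X * Z) * (X * Y)"
      by (rule assoc_mult_mat[of _ a a _ b _ a]) (use X Yc Zc in auto)
    also have "\<dots> = transpose_mat (X * Z) * transpose_mat (X * Y)"
      using Y Z by (simp add: is_pinv_def)
    also have "\<dots> = transpose_mat ((X * Y) * (X * Z))"
      using X Yc Zc by (subst transpose_mult[of _ a a _ a]) auto
    also have "(X * Y) * (X * Z) = (X * Y * X) * Z"
      by (rule assoc_mult_mat[of _ a a _ b _ a, symmetric]) (use X Yc Zc in auto)
    also have "\<dots> = X * Z" using Y by (simp add: is_pinv_def)
    finally show ?thesis using Z by (simp add: is_pinv_def)
  qed
  have 2: "Y * X = Z * X"
  proof -
    have "Y * X = Y * (X * Z * X)" using Z by (simp add: is_pinv_def)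
    also have "\<dots> = (Y * X) * (Z * X)" using X Yc Zc 
      by (simp add: assoc_mult_mat[of Y b a X b "Z * X" b] assoc_mult_mat[of X a b Z a X b])
    also have "\<dots> = transpose_mat (Y * X) * transpose_mat (Z * X)"
      using Y Z by (simp add: is_pinv_def)
    also have "\<dots> = transpose_mat ((Z * X) * (Y * X))"
      using X Yc Zc by (subst transpose_mult[of _ b b _ b]) auto
    also have "(Z * X) * (Y * X) = Z * (X * Y * X)"
      using X Yc Zc by (simp add: assoc_mult_mat[of Z b a X b "Y * X" b] assoc_mult_mat[of X a b Y a X b])
    also have "\<dots> = Z * X" using Y by (simp add: is_pinv_def)
    finally show ?thesis using Z by (simp add: is_pinv_def)
  qed
  have "Y = Y * X * Y" using Y by (simp add: is_pinv_def)
  also have "\<dots> = Z * X * Y" by (simp add: 2)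
  also have "\<dots> = Z * (X * Y)" using X Yc Zc by simp
  also have "\<dots> = Z * X * Z" using X Yc Zc by (simp add: 1)
  also have "\<dots> = Z" using Z by (simp add: is_pinv_def)
  finally show ?thesis .
qed

lemma full_column_rank_inj:
  assumes X: "X \<in> carrier_mat a b" and r: "full_column_rank X"
    and v: "v \<in> carrier_vec b" and 0: "X *\<^sub>v v = 0\<^sub>v a"
  shows "v = 0\<^sub>v b"
proof (rule ccontr)
  assume nz: "v \<noteq> 0\<^sub>v b"
  interpret V: vec_space "TYPE(real)" a .
  have rk: "V.rank X = b" using r X by (auto simp: full_column_rank_def)
  have d: "distinct (cols X)"
  proof (rule ccontr)
    assume nd: "\<not> distinct (cols X)"
    obtain S where S: "maximal S (\<lambda>T. T \<subseteq> set (cols X) \<and> V.lin_indpt T)"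
      using maximal_exists[of "(\<lambda>T. T \<subseteq> set (cols X) \<and> V.lin_indpt T)" "card (set (cols X))" "{}"]
      by (meson List.finite_set card_mono empty_iff empty_subsetI V.finite_lin_indpt2 rev_finite_subset)
    have "S \<subseteq> set (cols X)" using S by (simp add: maximal_def)
    hence "card S \<le> card (set (cols X))" by (simp add: card_mono)
    also have "\<dots> < length (cols X)" using nd card_distinct card_length le_neq_implies_less by blast
    finally show False using V.rank_card_indpt[OF X S] rk X by simp
  qed
  show False
    using V.lin_depI[OF X v nz 0 d] V.full_rank_lin_indpt[OF X rk d] by simp
qed

lemma is_pinv_exists:
  assumes r: "full_column_rank X"
  shows "\<exists>Y. is_pinv X Y"
proof -
  define a b where "a = dim_row X" and "b = dim_col X"
  have X: "X \<in> carrier_mat a b" by (simp add: a_def b_def)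
  let ?T = "transpose_mat X"
  have T: "?T \<in> carrier_mat b a" using X by simp
  let ?N = "?T * X"
  have N: "?N \<in> carrier_mat b b" using X by simp
  have "det ?N \<noteq> 0"
  proof
    assume "det ?N = 0"
    then obtain v where v: "v \<in> carrier_vec b" "v \<noteq> 0\<^sub>v b" "?N *\<^sub>v v = 0\<^sub>v b"
      using det_0_iff_vec_prod_zero_field[OF N] by auto
    have Xv: "X *\<^sub>v v \<in> carrier_vec a" using X v by simp
    have "(X *\<^sub>v v) \<bullet> (X *\<^sub>v v) = v \<bullet> (?T *\<^sub>v (X *\<^sub>v v))"
      using transpose_vec_mult_scalar[OF X v(1) Xv] comm_scalar_prod[of v b "?T *\<^sub>v (X *\<^sub>v v)"] v T Xv
      by simp
    also have "\<dots> = 0" using X v assoc_mult_mat_vec[OF T X v(1)] by simp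
    finally have "(\<Sum>i<a. (X *\<^sub>v v) $ i * (X *\<^sub>v v) $ i) = 0"
      unfolding scalar_prod_def atLeast0LessThan carrier_vecD[OF Xv] .
    hence "\<forall>i\<in>{..<a}. (X *\<^sub>v v) $ i * (X *\<^sub>v v) $ i = 0"
      by (subst (asm) sum_nonneg_eq_0_iff) auto
    hence "X *\<^sub>v v = 0\<^sub>v a" using X by (intro eq_vecI) auto
    thus False using full_column_rank_inj[OF X r v(1)] v(2) by simp
  qed
  then obtain C where C: "C \<in> carrier_mat b b" "C * ?N = 1\<^sub>m b" "?N * C = 1\<^sub>m b"
    using det_non_zero_imp_unit[OF N, of "()"]
    by (auto simp: Units_def ring_mat_def)
  have tN: "transpose_mat ?N = ?N" using X T by (subst transpose_mult[OF T X]) simp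
  have tC: "transpose_mat C = C"
  proof -
    have "transpose_mat C * ?N = transpose_mat (?N * C)"
      using transpose_mult[OF N C(1)] tN by simp
    also have "\<dots> = 1\<^sub>m b" using C by simp
    finally have e: "transpose_mat C * ?N = 1\<^sub>m b" .
    have "transpose_mat C = transpose_mat C * (?N * C)" using C by simp
    also have "\<dots> = (transpose_mat C * ?N) * C" using C N by (simp add: assoc_mult_mat[of _ b b _ b _ b])
    also have "\<dots> = C" using e C by simp
    finally show ?thesis .
  qed
  let ?Y = "C * ?T"
  have Yc: "?Y \<in> carrier_mat b a" using C T by simp
  have YX: "?Y * X = 1\<^sub>m b" using C X T by (simp add: assoc_mult_mat[OF C(1) T X])
  have "X * ?Y * X = X" using X Yc YX by (simp add: assoc_mult_mat[OF X Yc X])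
  moreover have "?Y * X * ?Y = ?Y" using left_mult_one_mat[OF Yc] by (simp only: YX)
  moreover have "transpose_mat (X * ?Y) = X * ?Y"
    using transpose_mult[OF X Yc] transpose_mult[OF C(1) T] tC X C T
    by (simp add: assoc_mult_mat[of _ a b _ b _ a])
  moreover have "transpose_mat (?Y * X) = ?Y * X" using YX by simp
  ultimately show ?thesis using Yc unfolding is_pinv_def a_def b_def by blast
qed

lemma is_pinv_pinv:
  assumes "full_column_rank X"
  shows "is_pinv X (pinv X)"
  unfolding pinv_def using is_pinv_exists[OF assms] is_pinv_unique by (metis theI)

definition superstable :: "real mat \<Rightarrow> real mat \<Rightarrow> bool" where
  "superstable W A \<longleftrightarrow> linf_norm (W * A * pinv W) < 1"

definition noise_bounded ::
  "nat \<Rightarrow> (nat \<Rightarrow> real mat) \<Rightarrow> (nat \<Rightarrow> real mat) \<Rightarrow> real vec \<Rightarrow> real vec \<Rightarrow> bool" where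
  "noise_bounded L F G dx du \<longleftrightarrow> (\<forall>l\<in>{1..L}. norm2 (F l *\<^sub>v dx + G l *\<^sub>v du) \<le> 1)"

definition noisy_observations ::
  "nat \<Rightarrow> nat \<Rightarrow> nat \<Rightarrow> nat \<Rightarrow> (nat \<Rightarrow> real mat) \<Rightarrow> (nat \<Rightarrow> real mat)
    \<Rightarrow> (nat \<Rightarrow> real vec) \<Rightarrow> (nat \<Rightarrow> real vec) \<Rightarrow> bool" where
  "noisy_observations n m T L F G xh uh \<longleftrightarrow>
     (\<exists>A\<in>carrier_mat n n. \<exists>B\<in>carrier_mat n m.
      \<exists>dx\<in>carrier_vec (n * T). \<exists>du\<in>carrier_vec (m * (T - 1)). \<exists>x u.
        (\<forall>t\<in>{1..T}. x t \<in> carrier_vec n \<and> xh t = x t + block n dx t)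
      \<and> (\<forall>t\<in>{1..T - 1}. u t \<in> carrier_vec m \<and> uh t = u t + block m du t)
      \<and> (\<forall>t\<in>{1..T - 1}. x (t + 1) = A *\<^sub>v x t + B *\<^sub>v u t)
      \<and> noise_bounded L F G dx du)"

definition residual ::
  "(nat \<Rightarrow> real vec) \<Rightarrow> (nat \<Rightarrow> real vec) \<Rightarrow> real mat \<Rightarrow> real mat \<Rightarrow> nat \<Rightarrow> real vec" where
  "residual xh uh A B t = xh (t + 1) - A *\<^sub>v xh t - B *\<^sub>v uh t"

definition joint_consistency_set ::
  "nat \<Rightarrow> nat \<Rightarrow> nat \<Rightarrow> nat \<Rightarrow> (nat \<Rightarrow> real mat) \<Rightarrow> (nat \<Rightarrow> real mat)
    \<Rightarrow> (nat \<Rightarrow> real vec) \<Rightarrow> (nat \<Rightarrow> real vec) \<Rightarrow> (real mat \<times> real mat \<times> real vec \<times> real vec) set"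
  where
  "joint_consistency_set n m T L F G xh uh =
     {(A, B, dx, du). A \<in> carrier_mat n n \<and> B \<in> carrier_mat n m
        \<and> dx \<in> carrier_vec (n * T) \<and> du \<in> carrier_vec (m * (T - 1))
        \<and> (\<forall>t\<in>{1..T - 1}. block n dx (t + 1)
              = A *\<^sub>v block n dx t + B *\<^sub>v block m du t + residual xh uh A B t)
        \<and> noise_bounded L F G dx du}"

definition consistent_plants ::
  "nat \<Rightarrow> nat \<Rightarrow> nat \<Rightarrow> nat \<Rightarrow> (nat \<Rightarrow> real mat) \<Rightarrow> (nat \<Rightarrow> real mat)
    \<Rightarrow> (nat \<Rightarrow> real vec) \<Rightarrow> (nat \<Rightarrow> real vec) \<Rightarrow> (real mat \<times> real mat) set" where
  "consistent_plants n m T L F G xh uh =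
     {(A, B). \<exists>dx du. (A, B, dx, du) \<in> joint_consistency_set n m T L F G xh uh}"

end

theory Submission
  imports Defs
begin

text \<open>
  The program linearizes the condition \<open>linf_norm (W * (A + B * K) * pinv W) < 1\<close> by bounding
  the absolute values entrywise: the two sign constraints say that \<open>M (A, B)\<close> dominates them, so
  every absolute row sum is at most a row sum of \<open>M (A, B)\<close>, hence at most \<open>1 - \<eta>\<close>. Although the
  constraints are indexed by quadruples in the joint consistency set, the certificate \<open>M\<close> depends
  on the plant alone; one noise realization that explains a given plant therefore suffices to
  bring all constraints for that plant into force.
\<close>

text \<open>
  The norm is a maximum over finitely many rows, so row-wise strict bounds suffice. With no rows
  it would be the maximum of the empty set, an unspecified number; hence the hypothesis that there
  is a row.
\<close>

lemma linf_norm_less: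
  assumes "dim_row X > 0"
    and "\<And>i. i < dim_row X \<Longrightarrow> (\<Sum>j<dim_col X. \<bar>X $$ (i, j)\<bar>) < c"
  shows "linf_norm X < c"
  unfolding linf_norm_def using assms by (subst Max_less_iff) (auto simp: lessThan_empty_iff)

theorem mainTheorem1:
  fixes n m L f T :: nat
    and r :: "nat \<Rightarrow> nat" and F G :: "nat \<Rightarrow> real mat"
    and xh uh :: "nat \<Rightarrow> real vec"
    and W K :: "real mat" and \<eta> :: real
    and M :: "real mat \<times> real mat \<Rightarrow> real mat"
  defines "Pbar \<equiv> joint_consistency_set n m T L F G xh uh"
    and "P \<equiv> consistent_plants n m T L F G xh uh"
  assumes "n \<ge> 1" "m \<ge> 1" "L \<ge> 1" "f \<ge> 1" "T \<ge> 2"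
    and "\<And>t. t \<in> {1..T} \<Longrightarrow> xh t \<in> carrier_vec n"
    and "\<And>t. t \<in> {1..T - 1} \<Longrightarrow> uh t \<in> carrier_vec m"
    and "\<And>l. l \<in> {1..L} \<Longrightarrow> F l \<in> carrier_mat (r l) (n * T)"
    and "\<And>l. l \<in> {1..L} \<Longrightarrow> G l \<in> carrier_mat (r l) (m * (T - 1))"
    and "noisy_observations n m T L F G xh uh"
    and "W \<in> carrier_mat f n" "full_column_rank W"
    and "\<eta> > 0"
    and "K \<in> carrier_mat m n"
    and "M \<in> P \<rightarrow> carrier_mat f f"
    and "\<And>A B dx du i. (A, B, dx, du) \<in> Pbar \<Longrightarrow> i < f \<Longrightarrow>
           1 - \<eta> - (\<Sum>j<f. M (A, B) $$ (i, j)) \<ge> 0"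
    and "\<And>A B dx du i j. (A, B, dx, du) \<in> Pbar \<Longrightarrow> i < f \<Longrightarrow> j < f \<Longrightarrow>
           M (A, B) $$ (i, j) - (W * (A + B * K) * pinv W) $$ (i, j) \<ge> 0
         \<and> M (A, B) $$ (i, j) + (W * (A + B * K) * pinv W) $$ (i, j) \<ge> 0"
  shows "\<forall>(A, B)\<in>P. superstable W (A + B * K)"
proof (intro ballI, clarify)
  fix A B
  assume "(A, B) \<in> P"
  then obtain dx du where joint: "(A, B, dx, du) \<in> Pbar"
    by (auto simp: P_def Pbar_def consistent_plants_def)
  let ?X = "W * (A + B * K) * pinv W"
  have dims: "dim_row ?X = f" "dim_col ?X = f"
    using is_pinv_pinv[OF \<open>full_column_rank W\<close>] \<open>W \<in> carrier_mat f n\<close>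
    by (auto simp: is_pinv_def)
  have "(\<Sum>j<f. \<bar>?X $$ (i, j)\<bar>) < 1" if i: "i < f" for i
  proof -
    have "\<bar>?X $$ (i, j)\<bar> \<le> M (A, B) $$ (i, j)" if j: "j < f" for j
      using assms(19)[OF joint i j] by linarith
    then have "(\<Sum>j<f. \<bar>?X $$ (i, j)\<bar>) \<le> (\<Sum>j<f. M (A, B) $$ (i, j))"
      by (intro sum_mono) auto
    with assms(18)[OF joint i] \<open>\<eta> > 0\<close> show ?thesis by linarith
  qed
  with dims \<open>f \<ge> 1\<close> show "superstable W (A + B * K)"
    unfolding superstable_def by (intro linf_norm_less) simp_all
qed

end
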